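(* Let $n\ge 1$, let $\rho=\{r_1,\ldots,r_n\}$ with $0<r_1<\cdots<r_n<\infty$, and let $\alpha,\nu_1,\nu_2,\ldots,\nu_n$ be arbitrary real values. (a) There exists a unique Beppo Levi $L_0$-spline $\sigma^A\in\mathcal{S}_0(\rho)$ such that $\sigma^A(r_j)=\nu_j$ for all $j\in\{1,\ldots,n\}$ and $\sigma^A(0)=\alpha$. (b) There exists a unique non-singular Beppo Levi $L_0$-spline $\sigma^B\in\mathcal{S}_0(\rho)$ such that $\sigma^B(r_j)=\nu_j$ for all $j\in\{1,\ldots,n\}$.
   Context: Define the differential operators $$L_0=r\frac{d^4}{dr^4}+2\frac{d^3}{dr^3}-\frac1r\frac{d^2}{dr^2}+\frac1{r^2}\frac{d}{dr},\quad G_0=\frac{d^3}{dr^3}-\frac1r\frac{d^2}{dr^2}+\frac1{r^2}\frac{d}{dr},\quad R_0=\frac1r\left[\frac{d^2}{dr^2}+\frac1r\frac{d}{dr}\right].$$ On any open subinterval of $(0,\infty)$ their null spaces are $\mathrm{Ker}\,L_0=\mathrm{span}\{r^2,r^2\ln r,1,\ln r\}$, $\mathrm{Ker}\,G_0=\mathrm{span}\{r^2,r^2\ln r,1\}$, $\mathrm{Ker}\,R_0=\mathrm{span}\{1,\ln r\}$. For knots $\rho=\{r_1<\cdots<r_n\}\subset(0,\infty)$, a function $\eta:[0,\infty)\to\mathbb{C}$, continuous at $0$, is called a Beppo Levi $L_0$-spline on $\rho$ if: (i) $L_0\eta(r)=0$ for all $r\in(r_j,r_{j+1})$ and all $j\in\{1,\ldots,n-1\}$;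 (ii) $G_0\eta(r)=0$ for all $r\in(0,r_1)$ and $R_0\eta(r)=0$ for all $r>r_n$; (iii) $\eta$ is $C^2$-continuous at each knot $r_1,\ldots,r_n$. The set of all such functions is $\mathcal{S}_0(\rho)$. A spline $\eta\in\mathcal{S}_0(\rho)$ is called non-singular if its restriction to $(0,r_1)$ belongs to $\mathrm{span}\{r^2,1\}$. *)

theory Defs
  imports "HOL-Analysis.Analysis" "HOL-Library.FuncSet"
begin

definition vderiv :: "(real \<Rightarrow> complex) \<Rightarrow> real \<Rightarrow> complex" where
  "vderiv f = (\<lambda>r. vector_derivative f (at r))"

definition times_differentiable_on :: "nat \<Rightarrow> (real \<Rightarrow> complex) \<Rightarrow> real set \<Rightarrow> bool" where
  "times_differentiable_on k f U \<longleftrightarrow>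
     (\<forall>j<k. \<forall>r\<in>U. (vderiv ^^ j) f differentiable (at r))"

definition L0 :: "(real \<Rightarrow> complex) \<Rightarrow> real \<Rightarrow> complex" where
  "L0 f r = r *\<^sub>R (vderiv ^^ 4) f r + 2 *\<^sub>R (vderiv ^^ 3) f r
            - (1 / r) *\<^sub>R (vderiv ^^ 2) f r + (1 / r\<^sup>2) *\<^sub>R vderiv f r"

definition G0 :: "(real \<Rightarrow> complex) \<Rightarrow> real \<Rightarrow> complex" where
  "G0 f r = (vderiv ^^ 3) f r - (1 / r) *\<^sub>R (vderiv ^^ 2) f r + (1 / r\<^sup>2) *\<^sub>R vderiv f r"

definition R0 :: "(real \<Rightarrow> complex) \<Rightarrow> real \<Rightarrow> complex" where
  "R0 f r = (1 / r) *\<^sub>R ((vderiv ^^ 2) f r + (1 / r) *\<^sub>R vderiv f r)"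

text \<open>\<^const>\<open>vector_derivative\<close> has an arbitrary value where a function is not differentiable,
  so the null spaces, taken on an open set, ask for differentiability up to the order of the
  operator.\<close>

definition Ker_L0 :: "real set \<Rightarrow> (real \<Rightarrow> complex) set" where
  "Ker_L0 U = {f. times_differentiable_on 4 f U \<and> (\<forall>r\<in>U. L0 f r = 0)}"

definition Ker_G0 :: "real set \<Rightarrow> (real \<Rightarrow> complex) set" where
  "Ker_G0 U = {f. times_differentiable_on 3 f U \<and> (\<forall>r\<in>U. G0 f r = 0)}"

definition Ker_R0 :: "real set \<Rightarrow> (real \<Rightarrow> complex) set" where
  "Ker_R0 U = {f. times_differentiable_on 2 f U \<and> (\<forall>r\<in>U. R0 f r = 0)}"

definition C2_at :: "(real \<Rightarrow> complex) \<Rightarrow> real \<Rightarrow> bool" where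
  "C2_at f a \<longleftrightarrow> (\<exists>U. open U \<and> a \<in> U \<and> times_differentiable_on 2 f U \<and>
                       continuous_on U ((vderiv ^^ 2) f))"

definition knots :: "nat \<Rightarrow> (nat \<Rightarrow> real) \<Rightarrow> bool" where
  "knots n \<rho> \<longleftrightarrow> 1 \<le> n \<and> 0 < \<rho> 1 \<and> strict_mono_on {1..n} \<rho>"

text \<open>Functions on \<open>[0, \<infinity>)\<close> are extensional functions on the real line, so that equality of
  splines is equality on \<open>[0, \<infinity>)\<close>. The knots are \<open>\<rho> 1, \<dots>, \<rho> n\<close>.\<close>

definition BL_splines :: "nat \<Rightarrow> (nat \<Rightarrow> real) \<Rightarrow> (real \<Rightarrow> complex) set" where
  "BL_splines n \<rho> = {\<eta> \<in> {0..} \<rightarrow>\<^sub>E UNIV.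
      continuous (at 0 within {0..}) \<eta> \<and>
      (\<forall>j\<in>{1..<n}. \<eta> \<in> Ker_L0 {\<rho> j<..<\<rho> (Suc j)}) \<and>
      \<eta> \<in> Ker_G0 {0<..<\<rho> 1} \<and>
      \<eta> \<in> Ker_R0 {\<rho> n<..} \<and>
      (\<forall>j\<in>{1..n}. C2_at \<eta> (\<rho> j))}"

definition nonsingular :: "(nat \<Rightarrow> real) \<Rightarrow> (real \<Rightarrow> complex) \<Rightarrow> bool" where
  "nonsingular \<rho> \<eta> \<longleftrightarrow>
     (\<exists>a b :: complex. \<forall>r\<in>{0<..<\<rho> 1}. \<eta> r = a * of_real (r\<^sup>2) + b)"

end

theory Submission
  imports Defs
begin

text \<open>
  The difference \<open>w\<close> of two splines with the same data vanishes at all knots. Uniqueness is an energy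
  argument for \<open>w\<close>. Since \<open>L0 w = (r (w'' + w' / r)')'\<close>, the quantity \<open>r (w'' + w' / r)'\<close> is a
  constant \<open>C\<close> between two neighbouring knots, and \<open>H = r w'' \<bullet> w' - C \<bullet> w\<close> has the
  derivative \<open>r |w''|^2 + |w'|^2 / r \<ge> 0\<close>. As \<open>w\<close> vanishes at the knots and is \<open>C^2\<close>, the number
  \<open>E j = r w'' \<bullet> w'\<close> at the \<open>j\<close>-th knot is nondecreasing in \<open>j\<close>. At the first knot it is
  nonnegative, by an explicit computation on \<open>(0, r1)\<close>, in which either \<open>w 0 = 0\<close> or the absence of
  the logarithm is used (\<open>first_piece_energy\<close>). At the last knot the condition \<open>r w'' + w' = 0\<close>,
  continued from the right, gives \<open>E n = - |w'|^2 \<le> 0\<close> (\<open>last_piece_energy\<close>). Therefore every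
  \<open>E j\<close> is zero, \<open>w'\<close> vanishes on each piece, and \<open>w\<close> is the constant \<open>0\<close>
  (\<open>weak_spline_eq_0\<close>, \<open>BL_splines_eqI\<close>).

  Existence is a shooting argument with a single real parameter. For each knot \<open>s\<close> the function
  \<open>knot_kernel s\<close> lies in the null space of \<open>L0\<close> and vanishes at \<open>s\<close> together with its first two
  derivatives, so replacing it by \<open>0\<close> to the left of \<open>s\<close> gives a \<open>C^2\<close> function. A function \<open>a r^2 + b r^2 ln r + c\<close> plus a
  combination of these truncated kernels satisfies every condition on a spline except harmonicity
  beyond the last knot, which amounts to two linear equations: the coefficients of \<open>r^2\<close> and
  \<open>r^2 ln r\<close> there have to vanish. The kernels are positive to the right of their knots, so
  interpolation determines the weights of the first \<open>n - 1\<close> of them one after the other; the last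
  weight cancels \<open>r^2 ln r\<close> (\<open>interpolate_by_knot_kernels\<close>). The remaining equation is affine in
  the one free parameter of the first piece, and its slope is not zero: otherwise there would be a
  nonzero spline with zero data, against uniqueness (\<open>shooting\<close>, \<open>vanishing_spline_fun\<close>).
\<close>

section \<open>The spline equations integrated once\<close>

lemma knot_location:
  assumes "knots n \<rho>" "0 < r"
  shows "r \<in> {0<..<\<rho> 1} \<or> r \<in> {\<rho> n<..} \<or> (\<exists>j\<in>{1..n}. r = \<rho> j) \<or> (\<exists>j\<in>{1..<n}. r \<in> {\<rho> j<..<\<rho> (Suc j)})"
proof (rule ccontr)
  assume c: "\<not> ?thesis"
  have "\<rho> j < r" if "1 \<le> j" "j \<le> n" for j
    using that
  proof (induction j rule: nat_induct_at_least)
    case base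
    then have "r \<noteq> \<rho> 1" "\<not> r < \<rho> 1" using c assms by auto
    then show ?case by simp
  next
    case (Suc j)
    then have "r \<noteq> \<rho> (Suc j)" "\<not> r < \<rho> (Suc j)" using c by auto
    then show ?case by simp
  qed
  from this[of n] show False using c assms by (auto simp: knots_def)
qed

lemma knots_less:
  assumes "knots n \<rho>" "1 \<le> i" "i < j" "j \<le> n"
  shows "\<rho> i < \<rho> j"
  using assms by (auto simp: knots_def strict_mono_on_def)

lemma knots_pos:
  assumes "knots n \<rho>" "1 \<le> i" "i \<le> n"
  shows "0 < \<rho> i"
  using knots_less[OF assms(1), of 1 i] assms by (cases "i = 1") (auto simp: knots_def)

lemma times_differentiable_onD:
  assumes "times_differentiable_on k f U" "j < k" "r \<in> U"
  shows "((vderiv ^^ j) f has_vector_derivative (vderiv ^^ Suc j) f r) (at r)"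
  using assms by (auto simp: times_differentiable_on_def vderiv_def vector_derivative_works)

lemma tendsto_square_mult_ln_at_right_0: "((\<lambda>r::real. r\<^sup>2 * ln r) \<longlongrightarrow> 0) (at_right 0)"
proof -
  have "((\<lambda>r::real. ln (inverse r) / inverse r) \<longlongrightarrow> 0) (at_right 0)"
    by (rule filterlim_compose[OF ln_x_over_x_tendsto_0 filterlim_inverse_at_top_right])
  then have "((\<lambda>r::real. - r * (ln (inverse r) / inverse r)) \<longlongrightarrow> - 0 * 0) (at_right 0)"
    by (intro tendsto_intros)
  moreover have "\<forall>\<^sub>F r::real in at_right 0. - r * (ln (inverse r) / inverse r) = r\<^sup>2 * ln r"
    unfolding eventually_at_right_field
    by (intro exI[of _ 1]) (auto simp: ln_inverse divide_inverse power2_eq_square)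
  ultimately show ?thesis
    by (simp add: tendsto_cong)
qed

text \<open>
  The conditions on a spline \<open>u\<close> with derivatives \<open>u1\<close>, \<open>u2\<close>, after one integration of each differential
  equation: \<open>G0 u = (u2 - u1 / r)'\<close>, \<open>L0 u = (r u2' + u2 - u1 / r)'\<close>. In this form the conditions
  pass to pointwise differences (splines themselves do not, because they are extensional), and the constant
  \<open>C\<close> that drives the energy estimate is explicit.
\<close>

definition weak_spline :: "nat \<Rightarrow> (nat \<Rightarrow> real) \<Rightarrow> (real \<Rightarrow> complex) \<Rightarrow> (real \<Rightarrow> complex)
    \<Rightarrow> (real \<Rightarrow> complex) \<Rightarrow> bool" where
  "weak_spline n \<rho> u u1 u2 \<longleftrightarrow>
     continuous (at 0 within {0..}) u \<and>
     (\<forall>r>0. (u has_vector_derivative u1 r) (at r) \<and> (u1 has_vector_derivative u2 r) (at r)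
             \<and> isCont u2 r) \<and>
     (\<exists>B. \<forall>r\<in>{0<..<\<rho> 1}. u2 r = u1 r /\<^sub>R r + B) \<and>
     (\<forall>j\<in>{1..<n}. \<exists>C. \<forall>r\<in>{\<rho> j<..<\<rho> (Suc j)}.
        (u2 has_vector_derivative (C - u2 r + u1 r /\<^sub>R r) /\<^sub>R r) (at r)) \<and>
     (\<forall>r>\<rho> n. r *\<^sub>R u2 r + u1 r = 0)"

lemma weak_spline_diff:
  assumes "weak_spline n \<rho> u u1 u2" "weak_spline n \<rho> v v1 v2"
  shows "weak_spline n \<rho> (\<lambda>r. u r - v r) (\<lambda>r. u1 r - v1 r) (\<lambda>r. u2 r - v2 r)"
  unfolding weak_spline_def
proof (intro conjI allI impI ballI)
  show "continuous (at 0 within {0..}) (\<lambda>r. u r - v r)"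
    using assms by (auto simp: weak_spline_def intro!: continuous_intros)
next
  obtain A B where "\<forall>r\<in>{0<..<\<rho> 1}. u2 r = u1 r /\<^sub>R r + A" "\<forall>r\<in>{0<..<\<rho> 1}. v2 r = v1 r /\<^sub>R r + B"
    using assms by (auto simp: weak_spline_def)
  then show "\<exists>B. \<forall>r\<in>{0<..<\<rho> 1}. u2 r - v2 r = (u1 r - v1 r) /\<^sub>R r + B"
    by (intro exI[of _ "A - B"]) (auto simp: algebra_simps)
next
  fix j assume "j \<in> {1..<n}"
  then obtain A B where
    "\<forall>r\<in>{\<rho> j<..<\<rho> (Suc j)}. (u2 has_vector_derivative (A - u2 r + u1 r /\<^sub>R r) /\<^sub>R r) (at r)"
    "\<forall>r\<in>{\<rho> j<..<\<rho> (Suc j)}. (v2 has_vector_derivative (B - v2 r + v1 r /\<^sub>R r) /\<^sub>R r) (at r)"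
    using assms unfolding weak_spline_def by meson
  then show "\<exists>C. \<forall>r\<in>{\<rho> j<..<\<rho> (Suc j)}. ((\<lambda>r. u2 r - v2 r) has_vector_derivative
      (C - (u2 r - v2 r) + (u1 r - v1 r) /\<^sub>R r) /\<^sub>R r) (at r)"
    by (intro exI[of _ "A - B"])
       (auto intro!: derivative_eq_intros simp: algebra_simps)
next
  fix r assume "\<rho> n < r"
  then have "r *\<^sub>R u2 r + u1 r = 0" "r *\<^sub>R v2 r + v1 r = 0"
    using assms unfolding weak_spline_def by blast+
  then have "(r *\<^sub>R u2 r + u1 r) - (r *\<^sub>R v2 r + v1 r) = 0"
    by simp
  then show "r *\<^sub>R (u2 r - v2 r) + (u1 r - v1 r) = 0"
    by (simp add: algebra_simps)
qed (use assms in \<open>auto simp: weak_spline_def intro!: derivative_intros\<close>)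

lemma funpow_vderiv [simp]: "(vderiv ^^ 2) f = vderiv (vderiv f)" "(vderiv ^^ 3) f = vderiv (vderiv (vderiv f))"
   "(vderiv ^^ 4) f = vderiv (vderiv (vderiv (vderiv f)))"
  by (simp_all add: eval_nat_numeral)

lemma Ker_L0_first_integral:
  assumes f: "f \<in> Ker_L0 {s<..<t}" and "0 \<le> s"
  shows "\<exists>C. \<forall>r\<in>{s<..<t}. (vderiv (vderiv f) has_vector_derivative
           (C - vderiv (vderiv f) r + vderiv f r /\<^sub>R r) /\<^sub>R r) (at r)"
proof -
  let ?f1 = "vderiv f" let ?f2 = "vderiv ?f1" let ?f3 = "vderiv ?f2" let ?f4 = "vderiv ?f3"
  have td: "times_differentiable_on 4 f {s<..<t}" using f by (simp add: Ker_L0_def)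
  have d1: "(?f1 has_vector_derivative ?f2 r) (at r)"
   and d2: "(?f2 has_vector_derivative ?f3 r) (at r)"
   and d3: "(?f3 has_vector_derivative ?f4 r) (at r)" if "r \<in> {s<..<t}" for r
    using times_differentiable_onD[OF td, of 1 r] times_differentiable_onD[OF td, of 2 r]
      times_differentiable_onD[OF td, of 3 r] that by simp_all
  have "((\<lambda>r. r *\<^sub>R ?f3 r + ?f2 r - ?f1 r /\<^sub>R r) has_vector_derivative 0) (at r within {s<..<t})"
    if r: "r \<in> {s<..<t}" for r
  proof -
    have "L0 f r = 0" and "r > 0" using f r \<open>0 \<le> s\<close> by (auto simp: Ker_L0_def)
    have "((\<lambda>r. r *\<^sub>R ?f3 r + ?f2 r - ?f1 r /\<^sub>R r) has_vector_derivative L0 f r) (at r)"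
      using \<open>r > 0\<close> unfolding L0_def funpow_vderiv
      by (auto intro!: derivative_eq_intros d1[OF r] d2[OF r] d3[OF r]
           simp: algebra_simps scaleR_2 power2_eq_square field_simps)
    then show ?thesis using \<open>L0 f r = 0\<close> by (simp add: has_vector_derivative_at_within)
  qed
  then obtain C where C: "\<And>r. r \<in> {s<..<t} \<Longrightarrow> r *\<^sub>R ?f3 r + ?f2 r - ?f1 r /\<^sub>R r = C"
    using has_vector_derivative_zero_constant[OF convex_real_interval(8)] by blast
  show ?thesis
  proof (intro exI[of _ C] ballI)
    fix r assume r: "r \<in> {s<..<t}"
    have "(C - ?f2 r + ?f1 r /\<^sub>R r) /\<^sub>R r = ?f3 r"
      using C[OF r] r \<open>0 \<le> s\<close> by (auto simp flip: C)
    then show "(?f2 has_vector_derivative (C - ?f2 r + ?f1 r /\<^sub>R r) /\<^sub>R r) (at r)"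
      using d2[OF r] by simp
  qed
qed

lemma Ker_G0_first_integral:
  assumes f: "f \<in> Ker_G0 {s<..<t}" and "0 \<le> s"
  shows "\<exists>B. \<forall>r\<in>{s<..<t}. vderiv (vderiv f) r = vderiv f r /\<^sub>R r + B"
proof -
  let ?f1 = "vderiv f" let ?f2 = "vderiv ?f1" let ?f3 = "vderiv ?f2"
  have td: "times_differentiable_on 3 f {s<..<t}" using f by (simp add: Ker_G0_def)
  have "((\<lambda>r. ?f2 r - ?f1 r /\<^sub>R r) has_vector_derivative 0) (at r within {s<..<t})"
    if r: "r \<in> {s<..<t}" for r
  proof -
    have d1: "(?f1 has_vector_derivative ?f2 r) (at r)"
      and d2: "(?f2 has_vector_derivative ?f3 r) (at r)"
      using times_differentiable_onD[OF td, of 1 r] times_differentiable_onD[OF td, of 2 r]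
      r by simp_all
    have "G0 f r = 0" and "r > 0" using f r \<open>0 \<le> s\<close> by (auto simp: Ker_G0_def)
    have "((\<lambda>r. ?f2 r - ?f1 r /\<^sub>R r) has_vector_derivative G0 f r) (at r)"
      using \<open>r > 0\<close> unfolding G0_def funpow_vderiv
      by (auto intro!: derivative_eq_intros d1 d2
           simp: algebra_simps power2_eq_square field_simps)
    then show ?thesis using \<open>G0 f r = 0\<close> by (simp add: has_vector_derivative_at_within)
  qed
  then obtain B where C: "\<And>r. r \<in> {s<..<t} \<Longrightarrow> ?f2 r - ?f1 r /\<^sub>R r = B"
    using has_vector_derivative_zero_constant[OF convex_real_interval(8)] by blast
  then show ?thesis by (intro exI[of _ B]) (auto simp: algebra_simps)
qed

text \<open>
  At a point of a piece, smoothness comes from the null space, and at a knot from the \<open>C^2\<close> condition. Beyond the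
  last knot only two derivatives are given, so there the continuity of the second one is read off from
  \<open>R0 \<eta> = 0\<close>, that is \<open>\<eta>'' = - \<eta>' / r\<close>.
\<close>

lemma BL_splines_weak:
  assumes kn: "knots n \<rho>" and f: "\<eta> \<in> BL_splines n \<rho>"
  shows "weak_spline n \<rho> \<eta> (vderiv \<eta>) (vderiv (vderiv \<eta>))"
proof -
  have n: "1 \<le> n" "0 < \<rho> 1" "0 < \<rho> n" using kn knots_pos[OF kn, of n] by (auto simp: knots_def)
  have R: "r *\<^sub>R vderiv (vderiv \<eta>) r + vderiv \<eta> r = 0" if "r > \<rho> n" for r
  proof -
    have r: "r > 0" using n that by simp
    have "R0 \<eta> r = 0" using f that by (auto simp: BL_splines_def Ker_R0_def)
    then have "vderiv (vderiv \<eta>) r + vderiv \<eta> r /\<^sub>R r = 0"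
      using r by (simp add: R0_def inverse_eq_divide)
    then have "r *\<^sub>R (vderiv (vderiv \<eta>) r + vderiv \<eta> r /\<^sub>R r) = 0" by simp
    then show ?thesis using r by (simp add: scaleR_add_right)
  qed
  have smooth: "(\<eta> has_vector_derivative vderiv \<eta> r) (at r) \<and>
      (vderiv \<eta> has_vector_derivative vderiv (vderiv \<eta>) r) (at r) \<and> isCont (vderiv (vderiv \<eta>)) r"
    if r: "r > 0" for r
  proof -
    have *: ?thesis if "times_differentiable_on k \<eta> U" "3 \<le> k" "r \<in> U" for U k
      using times_differentiable_onD[OF that(1), of 0 r] times_differentiable_onD[OF that(1), of 1 r]
        times_differentiable_onD[OF that(1), of 2 r] that(2,3)
      by (auto intro: has_vector_derivative_continuous)
    consider "r \<in> {0<..<\<rho> 1}" | "r \<in> {\<rho> n<..}" | j where "j \<in> {1..n}" "r = \<rho> j"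
      | j where "j \<in> {1..<n}" "r \<in> {\<rho> j<..<\<rho> (Suc j)}"
      using knot_location[OF kn r] by blast
    then show ?thesis
    proof cases
      case 1
      then show ?thesis using f *[of 3 "{0<..<\<rho> 1}"] by (auto simp: BL_splines_def Ker_G0_def)
    next
      case 2
      have td: "times_differentiable_on 2 \<eta> {\<rho> n<..}"
        using f by (auto simp: BL_splines_def Ker_R0_def)
      have d: "(\<eta> has_vector_derivative vderiv \<eta> r) (at r)"
        "(vderiv \<eta> has_vector_derivative vderiv (vderiv \<eta>) r) (at r)"
        using times_differentiable_onD[OF td, of 0 r] times_differentiable_onD[OF td, of 1 r] 2
        by simp_all
      have "isCont (\<lambda>r. - (vderiv \<eta> r /\<^sub>R r)) r"
        using has_vector_derivative_continuous[OF d(2)] r by (intro continuous_intros) auto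
      moreover have ev: "\<forall>\<^sub>F x in nhds r. - (vderiv \<eta> x /\<^sub>R x) = vderiv (vderiv \<eta>) x"
      proof -
        have "\<forall>\<^sub>F x in nhds r. x \<in> {\<rho> n<..}" using 2 by (intro eventually_nhds_in_open) auto
        then show ?thesis
        proof eventually_elim
          case (elim x)
          then have "x > 0" "vderiv \<eta> x = - (x *\<^sub>R vderiv (vderiv \<eta>) x)"
            using R[of x] n by (auto simp: add_eq_0_iff)
          then show ?case by simp
        qed
      qed
      ultimately show ?thesis using d isCont_cong[OF ev] by simp
    next
      case 3
      then obtain U where U: "open U" "r \<in> U" "times_differentiable_on 2 \<eta> U"
          "continuous_on U (vderiv (vderiv \<eta>))"
        using f unfolding BL_splines_def C2_at_def funpow_vderiv by blast
      then show ?thesis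
        using times_differentiable_onD[OF U(3), of 0 r] times_differentiable_onD[OF U(3), of 1 r]
        by (auto simp: continuous_on_eq_continuous_at)
    next
      case 4
      then show ?thesis using f *[of 4 "{\<rho> j<..<\<rho> (Suc j)}"] by (auto simp: BL_splines_def Ker_L0_def)
    qed
  qed
  have "\<exists>C. \<forall>r\<in>{\<rho> j<..<\<rho> (Suc j)}. (vderiv (vderiv \<eta>) has_vector_derivative
           (C - vderiv (vderiv \<eta>) r + vderiv \<eta> r /\<^sub>R r) /\<^sub>R r) (at r)" if "j \<in> {1..<n}" for j
    using f that knots_pos[OF kn, of j]
    by (intro Ker_L0_first_integral) (auto simp: BL_splines_def)
  moreover have "\<exists>B. \<forall>r\<in>{0<..<\<rho> 1}. vderiv (vderiv \<eta>) r = vderiv \<eta> r /\<^sub>R r + B"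
    using f by (intro Ker_G0_first_integral) (auto simp: BL_splines_def)
  ultimately show ?thesis
    unfolding weak_spline_def using f smooth R by (auto simp: BL_splines_def)
qed

section \<open>The energy of a spline that vanishes at the knots\<close>

lemma agree_at_right_endpoint:
  fixes f g :: "real \<Rightarrow> 'a::t2_space"
  assumes "s < t" "isCont f t" "isCont g t" "\<And>r. s < r \<Longrightarrow> r < t \<Longrightarrow> f r = g r"
  shows "f t = g t"
proof -
  have "(f \<longlongrightarrow> f t) (at_left t)" "(g \<longlongrightarrow> g t) (at_left t)"
    using assms(2,3) by (auto simp: isCont_def filterlim_at_split)
  moreover have ev: "\<forall>\<^sub>F r in at_left t. f r = g r"
    using assms(1,4) by (auto simp: eventually_at_left_field)
  ultimately show ?thesis
    using tendsto_unique[OF trivial_limit_at_left_real] tendsto_cong[OF ev] by blast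
qed

lemma agree_at_left_endpoint:
  fixes f g :: "real \<Rightarrow> 'a::t2_space"
  assumes "s < t" "isCont f s" "isCont g s" "\<And>r. s < r \<Longrightarrow> r < t \<Longrightarrow> f r = g r"
  shows "f s = g s"
proof -
  have "(f \<longlongrightarrow> f s) (at_right s)" "(g \<longlongrightarrow> g s) (at_right s)"
    using assms(2,3) by (auto simp: isCont_def filterlim_at_split)
  moreover have ev: "\<forall>\<^sub>F r in at_right s. f r = g r"
    using assms(1,4) by (auto simp: eventually_at_right_field)
  ultimately show ?thesis
    using tendsto_unique[OF trivial_limit_at_right_real] tendsto_cong[OF ev] by blast
qed

lemma weak_splineD:
  assumes "weak_spline n \<rho> u u1 u2" "0 < r"
  shows "(u has_vector_derivative u1 r) (at r)" "(u1 has_vector_derivative u2 r) (at r)"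
    "isCont u r" "isCont u1 r" "isCont u2 r"
proof -
  show *: "(u has_vector_derivative u1 r) (at r)" "(u1 has_vector_derivative u2 r) (at r)" "isCont u2 r"
    using assms by (auto simp: weak_spline_def)
  show "isCont u r" "isCont u1 r"
    using *(1,2) by (auto intro: has_vector_derivative_continuous)
qed

text \<open>
  Dividing \<open>w2 = w1 / r + B\<close> by \<open>r\<close> gives \<open>(w1 / r)' = B / r\<close>; two integrations lead to the null space of
  \<open>G0\<close>. The constant term is \<open>w 0\<close> since \<open>r^2\<close> and \<open>r^2 ln r\<close> both tend to \<open>0\<close>.
\<close>

lemma first_piece_form:
  assumes w: "weak_spline n \<rho> w w1 w2"
  obtains A B where "\<And>r. 0 < r \<Longrightarrow> r < \<rho> 1 \<Longrightarrow>
    w r = A * of_real (r\<^sup>2) + B * of_real (r\<^sup>2 * ln r) + w 0"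
proof (cases "0 < \<rho> 1")
  case True
  let ?I = "{0<..<\<rho> 1}"
  obtain B where B: "\<And>r. r \<in> ?I \<Longrightarrow> w2 r = w1 r /\<^sub>R r + B"
    using w by (auto simp: weak_spline_def)
  have "((\<lambda>r. w1 r /\<^sub>R r - ln r *\<^sub>R B) has_vector_derivative 0) (at r within ?I)" if r: "r \<in> ?I" for r
  proof -
    note d = weak_splineD[OF w, of r]
    have "((\<lambda>r. w1 r /\<^sub>R r - ln r *\<^sub>R B) has_vector_derivative 0) (at r)"
      using r d B[OF r] by (auto intro!: derivative_eq_intros simp: algebra_simps field_simps power2_eq_square)
    then show ?thesis by (rule has_vector_derivative_at_within)
  qed
  then obtain K where K: "\<And>r. r \<in> ?I \<Longrightarrow> w1 r /\<^sub>R r - ln r *\<^sub>R B = K"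
    using has_vector_derivative_zero_constant[OF convex_real_interval(8)] by blast
  have w1: "w1 r = r *\<^sub>R K + (r * ln r) *\<^sub>R B" if r: "r \<in> ?I" for r
  proof -
    have "r *\<^sub>R (w1 r /\<^sub>R r) = r *\<^sub>R (K + ln r *\<^sub>R B)"
      using K[OF r] by (simp add: algebra_simps)
    then show ?thesis using r by (simp add: algebra_simps)
  qed
  define h where "h r = r\<^sup>2 *\<^sub>R (K /\<^sub>R 2 - B /\<^sub>R 4) + (r\<^sup>2 * ln r) *\<^sub>R (B /\<^sub>R 2)" for r
  have "((\<lambda>r. w r - h r) has_vector_derivative 0) (at r within ?I)" if r: "r \<in> ?I" for r
  proof -
    have "(h has_vector_derivative w1 r) (at r)"
      unfolding h_def w1[OF r] using r
      by (auto intro!: derivative_eq_intros simp: algebra_simps power2_eq_square simp flip: scaleR_add_left)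
    then have "((\<lambda>r. w r - h r) has_vector_derivative w1 r - w1 r) (at r)"
      using r weak_splineD(1)[OF w, of r] by (intro derivative_intros) auto
    then show ?thesis by (simp add: has_vector_derivative_at_within)
  qed
  then obtain C where C: "\<And>r. r \<in> ?I \<Longrightarrow> w r - h r = C"
    using has_vector_derivative_zero_constant[OF convex_real_interval(8)] by blast
  have "(w \<longlongrightarrow> w 0) (at_right 0)"
    using w by (auto simp: weak_spline_def continuous_within intro: tendsto_within_subset)
  moreover have "((\<lambda>r. h r + C) \<longlongrightarrow> 0 *\<^sub>R (K /\<^sub>R 2 - B /\<^sub>R 4) + 0 *\<^sub>R (B /\<^sub>R 2) + C) (at_right 0)"
    unfolding h_def
    by (intro tendsto_intros tendsto_square_mult_ln_at_right_0) (auto intro!: tendsto_eq_intros)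
  moreover have ev: "\<forall>\<^sub>F r in at_right 0. w r = h r + C"
    using True C unfolding eventually_at_right_field by (intro exI[of _ "\<rho> 1"]) (auto simp: diff_eq_eq add.commute)
  ultimately have "w 0 = 0 *\<^sub>R (K /\<^sub>R 2 - B /\<^sub>R 4) + 0 *\<^sub>R (B /\<^sub>R 2) + C"
    using tendsto_unique[OF trivial_limit_at_right_real] tendsto_cong[OF ev] by blast
  then have "w 0 = C" by simp
  show ?thesis
  proof (rule that)
    fix r assume "0 < r" "r < \<rho> 1"
    then show "w r = (K /\<^sub>R 2 - B /\<^sub>R 4) * of_real (r\<^sup>2) + (B /\<^sub>R 2) * of_real (r\<^sup>2 * ln r) + w 0"
      using C[of r] \<open>w 0 = C\<close> by (auto simp: h_def scaleR_conv_of_real algebra_simps)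
  qed
qed auto

text \<open>
  The two admissible kinds of data on the first piece give the same sign. If \<open>B = 0\<close>, then \<open>w' = 2 A r\<close> and
  \<open>w'' = 2 A\<close>. If \<open>C = 0\<close>, then \<open>w = 0\<close> at the first knot forces \<open>w = B r^2 ln (r / \<rho> 1)\<close>, so there
  \<open>w' = B r\<close> and \<open>w'' = 3 B\<close>.
\<close>

lemma first_piece_energy:
  fixes w w1 w2 :: "real \<Rightarrow> complex"
  assumes w: "weak_spline n \<rho> w w1 w2" and s: "0 < \<rho> 1" "w (\<rho> 1) = 0"
    and form: "\<And>r. 0 < r \<Longrightarrow> r < \<rho> 1 \<Longrightarrow> w r = A * of_real (r\<^sup>2) + B * of_real (r\<^sup>2 * ln r) + C"
    and BC: "B = 0 \<or> C = 0"
  shows "0 \<le> w2 (\<rho> 1) \<bullet> w1 (\<rho> 1)"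
    and "w2 (\<rho> 1) \<bullet> w1 (\<rho> 1) = 0 \<Longrightarrow> 0 < r \<Longrightarrow> r < \<rho> 1 \<Longrightarrow> w1 r = 0"
proof -
  define f where "f r = A * of_real (r\<^sup>2) + B * of_real (r\<^sup>2 * ln r) + C" for r
  define f1 where "f1 r = A * of_real (2 * r) + B * of_real (2 * r * ln r + r)" for r
  define f2 where "f2 r = A * 2 + B * of_real (2 * ln r + 3)" for r
  have df: "(f has_vector_derivative f1 r) (at r)" "(f1 has_vector_derivative f2 r) (at r)" "isCont f2 r"
    if "0 < r" for r
  proof -
    show "(f has_vector_derivative f1 r) (at r)"
      unfolding f_def f1_def using that
      by (auto intro!: derivative_eq_intros simp: algebra_simps power2_eq_square)
    show "(f1 has_vector_derivative f2 r) (at r)"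
      unfolding f1_def f2_def using that
      by (auto intro!: derivative_eq_intros simp: algebra_simps power2_eq_square)
    show "isCont f2 r"
      unfolding f2_def using that by (intro continuous_intros) auto
  qed
  have wf: "w r = f r" if "r \<in> {0<..<\<rho> 1}" for r
    using form that by (simp add: f_def)
  have w1: "w1 r = f1 r" if r: "r \<in> {0<..<\<rho> 1}" for r
  proof -
    have "(w has_vector_derivative w1 r) (at r)"
      using weak_splineD(1)[OF w, of r] r by simp
    then have "(f has_vector_derivative w1 r) (at r)"
      by (rule has_vector_derivative_transform_within_open[OF _ open_greaterThanLessThan r wf])
    then show ?thesis using vector_derivative_unique_at[OF _ df(1)] r by simp
  qed
  have w2: "w2 r = f2 r" if r: "r \<in> {0<..<\<rho> 1}" for r
  proof -
    have "(w1 has_vector_derivative w2 r) (at r)"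
      using weak_splineD(2)[OF w, of r] r by simp
    then have "(f1 has_vector_derivative w2 r) (at r)"
      by (rule has_vector_derivative_transform_within_open[OF _ open_greaterThanLessThan r w1])
    then show ?thesis using vector_derivative_unique_at[OF _ df(2)] r by simp
  qed
  have 0: "f (\<rho> 1) = 0"
    using agree_at_right_endpoint[OF s(1) weak_splineD(3)[OF w s(1)]
      has_vector_derivative_continuous[OF df(1)[OF s(1)]]] wf s(2) by simp
  have 1: "w1 (\<rho> 1) = f1 (\<rho> 1)"
    using agree_at_right_endpoint[OF s(1) weak_splineD(4)[OF w s(1)]
      has_vector_derivative_continuous[OF df(2)[OF s(1)]]] w1 by simp
  have 2: "w2 (\<rho> 1) = f2 (\<rho> 1)"
    using agree_at_right_endpoint[OF s(1) weak_splineD(5)[OF w s(1)] df(3)[OF s(1)]] w2 by simp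
  have "0 \<le> w2 (\<rho> 1) \<bullet> w1 (\<rho> 1) \<and> (w2 (\<rho> 1) \<bullet> w1 (\<rho> 1) = 0 \<longrightarrow> A = 0 \<and> B = 0)"
    using BC
  proof
    assume "B = 0"
    then have "w2 (\<rho> 1) = 2 *\<^sub>R A" "w1 (\<rho> 1) = (2 * \<rho> 1) *\<^sub>R A"
      unfolding 1 2 f1_def f2_def by (simp_all add: scaleR_conv_of_real)
    then show ?thesis using s(1) \<open>B = 0\<close> by auto
  next
    assume "C = 0"
    then have "of_real ((\<rho> 1)\<^sup>2) * (A + B * of_real (ln (\<rho> 1))) = 0"
      using 0 by (simp add: f_def algebra_simps)
    then have A: "A = - (B * of_real (ln (\<rho> 1)))"
      using s(1) by (simp add: add_eq_0_iff2)
    have "w2 (\<rho> 1) = 3 *\<^sub>R B" "w1 (\<rho> 1) = \<rho> 1 *\<^sub>R B"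
      unfolding 1 2 f1_def f2_def A by (simp_all add: algebra_simps scaleR_conv_of_real)
    then show ?thesis using s(1) A by auto
  qed
  then show "0 \<le> w2 (\<rho> 1) \<bullet> w1 (\<rho> 1)"
    and "w2 (\<rho> 1) \<bullet> w1 (\<rho> 1) = 0 \<Longrightarrow> 0 < r \<Longrightarrow> r < \<rho> 1 \<Longrightarrow> w1 r = 0"
    using w1[of r] by (auto simp: f1_def)
qed

lemma middle_piece_energy:
  fixes w w1 w2 :: "real \<Rightarrow> complex"
  assumes w: "weak_spline n \<rho> w w1 w2" and st: "0 < s" "s < t" "w s = 0" "w t = 0"
    and C: "\<And>r. r \<in> {s<..<t} \<Longrightarrow> (w2 has_vector_derivative (C - w2 r + w1 r /\<^sub>R r) /\<^sub>R r) (at r)"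
  shows "s * (w2 s \<bullet> w1 s) \<le> t * (w2 t \<bullet> w1 t)"
    and "s * (w2 s \<bullet> w1 s) = t * (w2 t \<bullet> w1 t) \<Longrightarrow> r \<in> {s<..<t} \<Longrightarrow> w1 r = 0"
proof -
  \<comment> \<open>The term \<open>C \<bullet> w\<close> absorbs the third derivative and vanishes at both ends.\<close>
  define H where "H r = r * (w2 r \<bullet> w1 r) - C \<bullet> w r" for r
  have dH: "(H has_real_derivative r * (w2 r \<bullet> w2 r) + (w1 r \<bullet> w1 r) / r) (at r)" if r: "r \<in> {s<..<t}" for r
  proof -
    have "r > 0" using r st by auto
    note d = weak_splineD[OF w this]
    have "((\<lambda>r. w2 r \<bullet> w1 r) has_real_derivative
        (w2 r \<bullet> w2 r + ((C - w2 r + w1 r /\<^sub>R r) /\<^sub>R r) \<bullet> w1 r)) (at r)"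
      unfolding has_real_derivative_iff_has_vector_derivative
      by (rule bounded_bilinear.has_vector_derivative[OF bounded_bilinear_inner C[OF r] d(2)])
    moreover have "((\<lambda>r. C \<bullet> w r) has_real_derivative (C \<bullet> w1 r)) (at r)"
      unfolding has_real_derivative_iff_has_vector_derivative
      by (rule bounded_linear.has_vector_derivative[OF bounded_linear_inner_right d(1)])
    ultimately show ?thesis unfolding H_def
      using \<open>r > 0\<close> by (auto intro!: derivative_eq_intros simp: field_simps inner_simps)
  qed
  have cH: "continuous_on {s..t} H"
    unfolding H_def using weak_splineD[OF w] st
    by (intro continuous_at_imp_continuous_on ballI continuous_intros) auto
  have mono: "H x \<le> H y" if "s \<le> x" "x \<le> y" "y \<le> t" for x y
  proof (rule DERIV_nonneg_imp_increasing_open[OF that(2)])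
    show "\<exists>D. DERIV H r :> D \<and> 0 \<le> D" if "x < r" "r < y" for r
      using dH[of r] \<open>s \<le> x\<close> \<open>y \<le> t\<close> that st(1)
      by (intro exI[of _ "r * (w2 r \<bullet> w2 r) + (w1 r \<bullet> w1 r) / r"]) auto
    show "continuous_on {x..y} H"
      using cH by (rule continuous_on_subset) (use that in auto)
  qed
  have ends: "H s = s * (w2 s \<bullet> w1 s)" "H t = t * (w2 t \<bullet> w1 t)"
    using st by (simp_all add: H_def)
  show "s * (w2 s \<bullet> w1 s) \<le> t * (w2 t \<bullet> w1 t)"
    using mono[of s t] st ends by simp
  assume eq: "s * (w2 s \<bullet> w1 s) = t * (w2 t \<bullet> w1 t)" and r: "r \<in> {s<..<t}"
  have "H x = H s" if "x \<in> {s<..<t}" for x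
    using mono[of s x] mono[of x t] that eq ends by auto
  then have "(H has_real_derivative 0) (at r)"
    using r by (intro has_field_derivative_transform_within_open[OF DERIV_const, of "{s<..<t}"]) auto
  then have "r * (w2 r \<bullet> w2 r) + (w1 r \<bullet> w1 r) / r = 0"
    using DERIV_unique dH[OF r] by blast
  moreover have "0 \<le> r * (w2 r \<bullet> w2 r)" "0 \<le> (w1 r \<bullet> w1 r) / r"
    using r st by auto
  ultimately have "(w1 r \<bullet> w1 r) / r = 0" by linarith
  then show "w1 r = 0" using r st by auto
qed

text \<open>
  The equation \<open>r w2 + w1 = 0\<close> extends to the last knot by continuity; it gives the boundary term, and it
  says that \<open>r w1\<close> is constant beyond the knot.
\<close>

lemma last_piece_energy:
  fixes w w1 w2 :: "real \<Rightarrow> complex"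
  assumes w: "weak_spline n \<rho> w w1 w2" and s: "0 < \<rho> n"
  shows "\<rho> n * (w2 (\<rho> n) \<bullet> w1 (\<rho> n)) = - (norm (w1 (\<rho> n)))\<^sup>2"
    and "w1 (\<rho> n) = 0 \<Longrightarrow> \<rho> n \<le> r \<Longrightarrow> w1 r = 0"
proof -
  have R: "r *\<^sub>R w2 r + w1 r = 0" if "\<rho> n \<le> r" for r
  proof (cases "r = \<rho> n")
    case True
    show ?thesis unfolding True
      using agree_at_left_endpoint[of "\<rho> n" "\<rho> n + 1" "\<lambda>r. r *\<^sub>R w2 r + w1 r" "\<lambda>_. 0"]
        weak_splineD[OF w s] w by (auto simp: weak_spline_def intro!: continuous_intros)
  qed (use that w in \<open>auto simp: weak_spline_def\<close>)
  have "w1 (\<rho> n) = - (\<rho> n *\<^sub>R w2 (\<rho> n))" using R[of "\<rho> n"] by (simp add: add_eq_0_iff)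
  then have "\<rho> n *\<^sub>R w2 (\<rho> n) = - w1 (\<rho> n)" by simp
  then have "(\<rho> n *\<^sub>R w2 (\<rho> n)) \<bullet> w1 (\<rho> n) = - (w1 (\<rho> n) \<bullet> w1 (\<rho> n))" by simp
  then show "\<rho> n * (w2 (\<rho> n) \<bullet> w1 (\<rho> n)) = - (norm (w1 (\<rho> n)))\<^sup>2"
    by (simp add: power2_norm_eq_inner)
  assume 0: "w1 (\<rho> n) = 0" and r: "\<rho> n \<le> r"
  have "((\<lambda>r. r *\<^sub>R w1 r) has_vector_derivative 0) (at r within {\<rho> n..})" if "r \<in> {\<rho> n..}" for r
  proof -
    have "((\<lambda>r. r *\<^sub>R w1 r) has_vector_derivative (r *\<^sub>R w2 r + w1 r)) (at r)"
      using weak_splineD[OF w, of r] that s by (auto intro!: derivative_eq_intros)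
    then show ?thesis using R that by (simp add: has_vector_derivative_at_within)
  qed
  then obtain c where "\<And>r. r \<in> {\<rho> n..} \<Longrightarrow> r *\<^sub>R w1 r = c"
    using has_vector_derivative_zero_constant[OF convex_real_interval(1)] by blast
  from this[of r] this[of "\<rho> n"] have "r *\<^sub>R w1 r = 0" using 0 r by simp
  then show "w1 r = 0" using r s by simp
qed

lemma weak_spline_eq_0:
  assumes kn: "knots n \<rho>" and w: "weak_spline n \<rho> w w1 w2"
    and 0: "\<And>j. j \<in> {1..n} \<Longrightarrow> w (\<rho> j) = 0"
    and form: "\<And>r. 0 < r \<Longrightarrow> r < \<rho> 1 \<Longrightarrow> w r = A * of_real (r\<^sup>2) + B * of_real (r\<^sup>2 * ln r) + C"
    and BC: "B = 0 \<or> C = 0" and r: "0 < r"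
  shows "w r = 0"
proof -
  define E where "E j = \<rho> j * (w2 (\<rho> j) \<bullet> w1 (\<rho> j))" for j
  have n: "1 \<le> n" "0 < \<rho> 1" "0 < \<rho> n" using kn knots_pos[OF kn, of n] by (auto simp: knots_def)
  have w\<rho>1: "w (\<rho> 1) = 0" using 0 n by simp
  note first = first_piece_energy[OF w n(2) w\<rho>1 form BC]
  note last = last_piece_energy[OF w n(3)]
  have mid: "E j \<le> E (Suc j) \<and> (E j = E (Suc j) \<longrightarrow> (\<forall>r \<in> {\<rho> j<..<\<rho> (Suc j)}. w1 r = 0))"
    if j: "j \<in> {1..<n}" for j
  proof -
    obtain C where C: "\<And>r. r \<in> {\<rho> j<..<\<rho> (Suc j)} \<Longrightarrow>
        (w2 has_vector_derivative (C - w2 r + w1 r /\<^sub>R r) /\<^sub>R r) (at r)"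
      using w j unfolding weak_spline_def by blast
    have "0 < \<rho> j" "\<rho> j < \<rho> (Suc j)" "w (\<rho> j) = 0" "w (\<rho> (Suc j)) = 0"
      using knots_pos[OF kn, of j] knots_less[OF kn, of j "Suc j"] 0 j by auto
    note * = middle_piece_energy[OF w this C]
    show ?thesis unfolding E_def by (intro conjI impI ballI *)
  qed
  have mono: "E i \<le> E j" if "1 \<le> i" "i \<le> j" "j \<le> n" for i j
    using that(2,1,3)
  proof (induction j rule: dec_induct)
    case (step j)
    then show ?case using mid[of j] by simp
  qed simp
  have E1: "0 \<le> E 1" using first(1) n by (simp add: E_def)
  have En: "E n = - (norm (w1 (\<rho> n)))\<^sup>2" using last(1) by (simp add: E_def)
  have E: "E j = 0" if "j \<in> {1..n}" for j
  proof -
    have "E 1 \<le> E j" "E j \<le> E n" using mono that by auto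
    then show ?thesis using E1 En zero_le_power2[of "norm (w1 (\<rho> n))"] by linarith
  qed
  have wn: "w1 (\<rho> n) = 0" using E[of n] En n by simp
  have pieces: "w1 r = 0" if "r \<in> {0<..<\<rho> 1} \<or> r \<in> {\<rho> n<..} \<or> (\<exists>j\<in>{1..<n}. r \<in> {\<rho> j<..<\<rho> (Suc j)})" for r
    using that
  proof (elim disjE bexE)
    show ?thesis if "r \<in> {0<..<\<rho> 1}" using first(2)[of r] E[of 1] n that by (auto simp: E_def)
    show ?thesis if "r \<in> {\<rho> n<..}" using last(2)[of r] wn that by simp
    show ?thesis if "j \<in> {1..<n}" "r \<in> {\<rho> j<..<\<rho> (Suc j)}" for j
      using mid[of j] E[of j] E[of "Suc j"] that by auto
  qed
  have w1: "w1 r = 0" if r: "0 < r" for r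
  proof (cases "\<exists>j\<in>{1..n}. r = \<rho> j")
    case True
    then obtain j where j: "j \<in> {1..n}" "r = \<rho> j" by auto
    show ?thesis
    proof (cases "j = n")
      case False
      then have j': "j \<in> {1..<n}" using j by simp
      have "w1 (\<rho> j) = 0"
      proof (rule agree_at_left_endpoint)
        show "\<rho> j < \<rho> (Suc j)" using knots_less[OF kn, of j "Suc j"] j' by simp
        show "isCont w1 (\<rho> j)" using weak_splineD(4)[OF w r] j by simp
        show "w1 r = 0" if "\<rho> j < r" "r < \<rho> (Suc j)" for r
          using pieces j' that by (meson greaterThanLessThan_iff)
      qed simp
      then show ?thesis using j by simp
    qed (use j wn in simp)
  next
    case False
    then show ?thesis using knot_location[OF kn r] pieces by blast
  qed
  have "(w has_vector_derivative 0) (at r within {0<..})" if "r \<in> {0<..}" for r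
    using weak_splineD(1)[OF w, of r] w1[of r] that by (simp add: has_vector_derivative_at_within)
  then obtain c where "\<And>r. r \<in> {0<..} \<Longrightarrow> w r = c"
    using has_vector_derivative_zero_constant[OF convex_real_interval(3)] by blast
  from this[of r] this[of "\<rho> 1"] show ?thesis using r n w\<rho>1 by simp
qed

text \<open>
  Both parts of the uniqueness claim at once: equality at \<open>0\<close> removes the constant term of the difference on the
  first piece, and nonsingularity removes its logarithm.
\<close>

lemma BL_splines_eqI:
  assumes kn: "knots n \<rho>" and f: "f \<in> BL_splines n \<rho>" and g: "g \<in> BL_splines n \<rho>"
    and eq: "\<And>j. j \<in> {1..n} \<Longrightarrow> f (\<rho> j) = g (\<rho> j)"
    and extra: "f 0 = g 0 \<or> nonsingular \<rho> f \<and> nonsingular \<rho> g"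
  shows "f = g"
proof -
  have n: "0 < \<rho> 1" using kn by (auto simp: knots_def)
  define w where "w r = f r - g r" for r
  have "weak_spline n \<rho> (\<lambda>r. f r - g r) (\<lambda>r. vderiv f r - vderiv g r)
      (\<lambda>r. vderiv (vderiv f) r - vderiv (vderiv g) r)"
    using BL_splines_weak[OF kn] f g by (intro weak_spline_diff)
  then obtain w1 w2 where w: "weak_spline n \<rho> w w1 w2" unfolding w_def by blast
  have "\<exists>A B C. (B = 0 \<or> C = 0) \<and>
      (\<forall>r\<in>{0<..<\<rho> 1}. w r = A * of_real (r\<^sup>2) + B * of_real (r\<^sup>2 * ln r) + C)"
    using extra
  proof
    assume "f 0 = g 0"
    then have "w 0 = 0" by (simp add: w_def)
    with first_piece_form[OF w] show ?thesis by (metis greaterThanLessThan_iff)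
  next
    assume "nonsingular \<rho> f \<and> nonsingular \<rho> g"
    then obtain a b a' b' where "\<forall>r\<in>{0<..<\<rho> 1}. f r = a * of_real (r\<^sup>2) + b"
      "\<forall>r\<in>{0<..<\<rho> 1}. g r = a' * of_real (r\<^sup>2) + b'" unfolding nonsingular_def by blast
    then show ?thesis
      by (intro exI[of _ "a - a'"] exI[of _ 0] exI[of _ "b - b'"]) (auto simp: w_def algebra_simps)
  qed
  then obtain A B C where BC: "B = 0 \<or> C = 0" and form: "\<And>r. 0 < r \<Longrightarrow> r < \<rho> 1 \<Longrightarrow>
      w r = A * of_real (r\<^sup>2) + B * of_real (r\<^sup>2 * ln r) + C"
    unfolding greaterThanLessThan_iff Ball_def by blast
  from weak_spline_eq_0[OF kn w _ form BC] eq have pos: "w r = 0" if "0 < r" for r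
    using that by (auto simp: w_def)
  have zero: "w 0 = 0"
  proof -
    have "(w \<longlongrightarrow> w 0) (at_right 0)"
      using w by (auto simp: weak_spline_def continuous_within intro: tendsto_within_subset)
    moreover have "(w \<longlongrightarrow> 0) (at_right 0)"
      by (rule tendsto_eventually) (auto simp: eventually_at_right_field pos intro: exI[of _ 1])
    ultimately show ?thesis
      using tendsto_unique[OF trivial_limit_at_right_real] by blast
  qed
  show ?thesis
  proof (rule PiE_ext[of f "{0..}" "\<lambda>_. UNIV" g])
    show "f r = g r" if "r \<in> {0..}" for r
      using pos[of r] zero that by (cases "r = 0") (auto simp: w_def)
  qed (use f g in \<open>simp_all add: BL_splines_def\<close>)
qed

section \<open>Splines built from truncated kernels\<close>

text \<open>
  Iterated derivatives are computed by exhibiting a chain of real functions, each the derivative of the one before.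
\<close>

lemma vderiv_of_real:
  fixes G :: "nat \<Rightarrow> real \<Rightarrow> real"
  assumes U: "open U" and f: "\<And>r. r \<in> U \<Longrightarrow> f r = of_real (G 0 r)"
    and G: "\<And>j r. j < k \<Longrightarrow> r \<in> U \<Longrightarrow> (G j has_real_derivative G (Suc j) r) (at r)"
  shows "j \<le> k \<Longrightarrow> r \<in> U \<Longrightarrow> (vderiv ^^ j) f r = of_real (G j r)"
    and "times_differentiable_on k f U"
proof -
  have step: "((vderiv ^^ j) f has_vector_derivative of_real (G (Suc j) r)) (at r)"
    if j: "j < k" and r: "r \<in> U" and eq: "\<And>r. r \<in> U \<Longrightarrow> (vderiv ^^ j) f r = of_real (G j r)" for j r
    by (rule has_vector_derivative_transform_within_open[OF has_vector_derivative_of_real[OF G[OF j r]] U r])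
       (simp add: eq)
  have eq: "(vderiv ^^ j) f r = of_real (G j r)" if "j \<le> k" "r \<in> U" for j r
    using that
  proof (induction j arbitrary: r)
    case 0
    then show ?case using f by simp
  next
    case (Suc j)
    then have "((vderiv ^^ j) f has_vector_derivative of_real (G (Suc j) r)) (at r)"
      by (intro step) auto
    then show ?case by (simp add: vderiv_def[of "(vderiv ^^ j) f"] vector_derivative_at)
  qed
  then show "j \<le> k \<Longrightarrow> r \<in> U \<Longrightarrow> (vderiv ^^ j) f r = of_real (G j r)" by blast
  show "times_differentiable_on k f U"
    unfolding times_differentiable_on_def
    using step eq by (meson differentiableI_vector less_imp_le)
qed

text \<open>
  The general element of the null space of \<open>L0 = r \<Delta>^2\<close>, where \<open>\<Delta>\<close> is the radial Laplacian of the plane.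
\<close>

definition radial_biharmonic :: "real \<Rightarrow> real \<Rightarrow> real \<Rightarrow> real \<Rightarrow> real \<Rightarrow> real" where
  "radial_biharmonic A B C D r = A * r\<^sup>2 + B * (r\<^sup>2 * ln r) + C + D * ln r"

lemma radial_biharmonic_kernels:
  assumes U: "open U" "U \<subseteq> {0<..}" and f: "\<And>r. r \<in> U \<Longrightarrow> f r = of_real (radial_biharmonic A B C D r)"
  shows "f \<in> Ker_L0 U"
    and "D = 0 \<Longrightarrow> f \<in> Ker_G0 U"
    and "A = 0 \<Longrightarrow> B = 0 \<Longrightarrow> f \<in> Ker_R0 U"
proof -
  define G :: "nat \<Rightarrow> real \<Rightarrow> real" where "G j r =
    [radial_biharmonic A B C D r,
     2 * A * r + B * (2 * r * ln r + r) + D / r,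
     2 * A + B * (2 * ln r + 3) - D / r\<^sup>2,
     2 * B / r + 2 * D / r ^ 3,
     - 2 * B / r\<^sup>2 - 6 * D / r ^ 4] ! j" for j r
  have G: "(G j has_real_derivative G (Suc j) r) (at r)" if "j < 4" "r \<in> U" for j r
  proof -
    have "r > 0" using that U by auto
    from \<open>j < 4\<close> consider "j = 0" | "j = 1" | "j = 2" | "j = 3" by linarith
    then show ?thesis
      unfolding G_def radial_biharmonic_def using \<open>r > 0\<close>
      by cases (auto intro!: derivative_eq_intros simp: field_simps power2_eq_square eval_nat_numeral)
  qed
  have f0: "\<And>r. r \<in> U \<Longrightarrow> f r = of_real (G 0 r)" using f by (simp add: G_def)
  have td: "times_differentiable_on k f U" if "k \<le> 4" for k
    using vderiv_of_real(2)[OF U(1) f0 G, of k] that by simp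
  have v: "(vderiv ^^ j) f r = of_real (G j r)" if "j \<le> 4" "r \<in> U" for j r
    using vderiv_of_real(1)[OF U(1) f0 G, of 4 j r] that by simp
  have v1: "vderiv f r = of_real (G 1 r)" if "r \<in> U" for r
    using v[of 1 r] that by simp
  have "L0 f r = 0" if r: "r \<in> U" for r
  proof -
    have "r > 0" using r U by auto
    have "L0 f r = of_real (r * G 4 r + 2 * G 3 r - 1 / r * G 2 r + 1 / r\<^sup>2 * G 1 r)"
      unfolding L0_def using v[OF _ r] v1[OF r] by (simp add: scaleR_conv_of_real del: funpow_vderiv)
    also have "r * G 4 r + 2 * G 3 r - 1 / r * G 2 r + 1 / r\<^sup>2 * G 1 r = 0"
      using \<open>r > 0\<close> by (simp add: G_def field_simps power2_eq_square eval_nat_numeral)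
    finally show ?thesis by simp
  qed
  then show "f \<in> Ker_L0 U" using td by (simp add: Ker_L0_def)
  have "G0 f r = 0" if r: "r \<in> U" "D = 0" for r
  proof -
    have "r > 0" using r U by auto
    have "G0 f r = of_real (G 3 r - 1 / r * G 2 r + 1 / r\<^sup>2 * G 1 r)"
      unfolding G0_def using v[OF _ r(1)] v1[OF r(1)] by (simp add: scaleR_conv_of_real del: funpow_vderiv)
    also have "G 3 r - 1 / r * G 2 r + 1 / r\<^sup>2 * G 1 r = 0"
      using \<open>r > 0\<close> r(2) by (simp add: G_def field_simps power2_eq_square eval_nat_numeral)
    finally show ?thesis by simp
  qed
  then show "D = 0 \<Longrightarrow> f \<in> Ker_G0 U" using td by (simp add: Ker_G0_def)
  have "R0 f r = 0" if r: "r \<in> U" "A = 0" "B = 0" for r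
  proof -
    have "r > 0" using r U by auto
    have "R0 f r = of_real (1 / r * (G 2 r + 1 / r * G 1 r))"
      unfolding R0_def using v[OF _ r(1)] v1[OF r(1)] by (simp add: scaleR_conv_of_real del: funpow_vderiv)
    also have "1 / r * (G 2 r + 1 / r * G 1 r) = 0"
      using \<open>r > 0\<close> r(2,3) by (simp add: G_def field_simps power2_eq_square eval_nat_numeral)
    finally show ?thesis by simp
  qed
  then show "A = 0 \<Longrightarrow> B = 0 \<Longrightarrow> f \<in> Ker_R0 U" using td by (simp add: Ker_R0_def)
qed

definition trunc :: "real \<Rightarrow> (real \<Rightarrow> real) \<Rightarrow> real \<Rightarrow> real" where
  "trunc s g r = (if r \<le> s then 0 else g r)"

lemma has_real_derivative_trunc:
  assumes g: "\<And>r. s \<le> r \<Longrightarrow> (g has_real_derivative g' r) (at r)" and 0: "g s = 0" "g' s = 0"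
  shows "(trunc s g has_real_derivative trunc s g' r) (at r)"
proof -
  consider "r < s" | "r = s" | "s < r" by linarith
  then show ?thesis
  proof cases
    case 1
    then have "(trunc s g has_real_derivative 0) (at r)"
      by (intro has_field_derivative_transform_within_open[OF DERIV_const[of 0], of "{..<s}"])
         (auto simp: trunc_def)
    then show ?thesis using 1 by (simp add: trunc_def)
  next
    case 3
    then have "(trunc s g has_real_derivative g' r) (at r)"
      by (intro has_field_derivative_transform_within_open[OF g, of r "{s<..}"])
         (auto simp: trunc_def)
    then show ?thesis using 3 by (simp add: trunc_def)
  next
    case 2
    have "(\<lambda>h. g (s + h) / h) \<midarrow>0\<rightarrow> 0"
      using g[of s] 0 by (simp add: DERIV_def)
    then have lim: "(\<lambda>h. norm (g (s + h) / h)) \<midarrow>0\<rightarrow> 0"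
      by (rule tendsto_norm_zero)
    have bound: "norm (trunc s g (s + h) / h) \<le> norm (g (s + h) / h)" for h
    proof (cases "h \<le> 0")
      case True
      then have "trunc s g (s + h) / h = 0" by (simp add: trunc_def)
      then show ?thesis by (metis norm_ge_zero norm_zero)
    qed (simp add: trunc_def)
    have "(\<lambda>h. trunc s g (s + h) / h) \<midarrow>0\<rightarrow> 0"
      by (rule Lim_null_comparison[OF always_eventually[OF allI[OF bound]] lim])
    then show ?thesis unfolding 2 using 0 by (simp add: DERIV_def trunc_def)
  qed
qed

lemma isCont_trunc:
  assumes g: "\<And>r. s \<le> r \<Longrightarrow> isCont g r" and 0: "g s = 0"
  shows "isCont (trunc s g) r"
proof -
  have "continuous_on ({..s} \<union> {s..}) (\<lambda>r. if r \<le> s then 0 else g r)"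
    using g 0 by (intro continuous_on_If continuous_on_const continuous_at_imp_continuous_on) auto
  moreover have "{..s} \<union> {s..} = UNIV" by auto
  ultimately show ?thesis
    by (simp add: trunc_def[abs_def] continuous_on_eq_continuous_at)
qed

text \<open>
  The element of the null space of \<open>L0\<close> that vanishes at \<open>s\<close> together with its first two derivatives, unique up to
  a factor.
\<close>

definition knot_kernel :: "real \<Rightarrow> real \<Rightarrow> real" where
  "knot_kernel s r = (r\<^sup>2 + s\<^sup>2) * (ln r - ln s) - (r\<^sup>2 - s\<^sup>2)"

definition knot_kernel1 :: "real \<Rightarrow> real \<Rightarrow> real" where
  "knot_kernel1 s r = 2 * r * (ln r - ln s) - r + s\<^sup>2 / r"

definition knot_kernel2 :: "real \<Rightarrow> real \<Rightarrow> real" where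
  "knot_kernel2 s r = 2 * (ln r - ln s) + 1 - s\<^sup>2 / r\<^sup>2"

lemma DERIV_knot_kernel:
  assumes "0 < r"
  shows "(knot_kernel s has_real_derivative knot_kernel1 s r) (at r)"
    and "(knot_kernel1 s has_real_derivative knot_kernel2 s r) (at r)"
    and "isCont (knot_kernel2 s) r"
proof -
  show "(knot_kernel s has_real_derivative knot_kernel1 s r) (at r)"
    unfolding knot_kernel_def knot_kernel1_def using assms
    by (auto intro!: derivative_eq_intros simp: field_simps power2_eq_square)
  show "(knot_kernel1 s has_real_derivative knot_kernel2 s r) (at r)"
    unfolding knot_kernel2_def knot_kernel1_def using assms
    by (auto intro!: derivative_eq_intros simp: field_simps power2_eq_square)
  show "isCont (knot_kernel2 s) r"
    unfolding knot_kernel2_def using assms by (intro continuous_intros) auto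
qed

lemma knot_kernel_at_knot:
  assumes "0 < s"
  shows "knot_kernel s s = 0" "knot_kernel1 s s = 0" "knot_kernel2 s s = 0"
  using assms by (auto simp: knot_kernel_def knot_kernel1_def knot_kernel2_def power2_eq_square)

text \<open>
  The second derivative is positive to the right of \<open>s\<close>, and the kernel and its first derivative start from \<open>0\<close> there.
\<close>

lemma knot_kernel_pos:
  assumes s: "0 < s" "s < r"
  shows "0 < knot_kernel s r"
proof -
  have pos2: "0 < knot_kernel2 s x" if "s < x" for x
  proof -
    have "s\<^sup>2 \<le> x\<^sup>2" "ln s < ln x" using s that by (auto intro: power_mono)
    then have "s\<^sup>2 / x\<^sup>2 \<le> 1" using s that by (simp add: divide_le_eq)
    then show ?thesis using \<open>ln s < ln x\<close> by (simp add: knot_kernel2_def)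
  qed
  have cont: "continuous_on {s..x} (knot_kernel s)" "continuous_on {s..x} (knot_kernel1 s)" for x
    using DERIV_knot_kernel(1,2)[THEN DERIV_isCont] s(1)
    by (auto intro!: continuous_at_imp_continuous_on)
  have pos1: "0 < knot_kernel1 s x" if "s < x" for x
  proof -
    have "knot_kernel1 s s < knot_kernel1 s x"
    proof (rule DERIV_pos_imp_increasing_open[OF that _ cont(2)])
      show "\<exists>D. DERIV (knot_kernel1 s) y :> D \<and> 0 < D" if "s < y" for y
        using DERIV_knot_kernel(2)[of y s] pos2[OF that] s(1) that by (intro exI conjI) auto
    qed
    then show ?thesis using knot_kernel_at_knot(2)[OF s(1)] by simp
  qed
  have "knot_kernel s s < knot_kernel s r"
  proof (rule DERIV_pos_imp_increasing_open[OF s(2) _ cont(1)])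
    show "\<exists>D. DERIV (knot_kernel s) y :> D \<and> 0 < D" if "s < y" for y
      using DERIV_knot_kernel(1)[of y s] pos1[OF that] s(1) that by (intro exI conjI) auto
  qed
  then show ?thesis using knot_kernel_at_knot(1)[OF s(1)] by simp
qed

text \<open>
  The coefficients of a combination of kernels; those of \<open>r^2\<close> and \<open>r^2 ln r\<close> are the obstructions to being
  harmonic.
\<close>

lemma sum_knot_kernel:
  "(\<Sum>i\<in>I. \<kappa> i * knot_kernel (\<rho> i) r) =
   radial_biharmonic (- (\<Sum>i\<in>I. \<kappa> i * (ln (\<rho> i) + 1))) (\<Sum>i\<in>I. \<kappa> i)
     (\<Sum>i\<in>I. \<kappa> i * ((\<rho> i)\<^sup>2 * (1 - ln (\<rho> i)))) (\<Sum>i\<in>I. \<kappa> i * (\<rho> i)\<^sup>2) r"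
proof -
  have "\<kappa> i * knot_kernel (\<rho> i) r =
      - (\<kappa> i * (ln (\<rho> i) + 1)) * r\<^sup>2 + \<kappa> i * (r\<^sup>2 * ln r)
      + \<kappa> i * ((\<rho> i)\<^sup>2 * (1 - ln (\<rho> i))) + \<kappa> i * (\<rho> i)\<^sup>2 * ln r" for i
    unfolding knot_kernel_def by algebra
  then show ?thesis
    by (simp only: radial_biharmonic_def sum.distrib sum_distrib_right[symmetric] sum_negf)
qed

definition spline_fun ::
  "nat \<Rightarrow> (nat \<Rightarrow> real) \<Rightarrow> real \<Rightarrow> real \<Rightarrow> real \<Rightarrow> (nat \<Rightarrow> real) \<Rightarrow> real \<Rightarrow> real" where
  "spline_fun n \<rho> a b c \<kappa> r =
     radial_biharmonic a b c 0 r + (\<Sum>i\<in>{1..n}. \<kappa> i * trunc (\<rho> i) (knot_kernel (\<rho> i)) r)"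

lemma spline_fun_piece:
  assumes "m \<le> n" "\<And>i. i \<in> {1..m} \<Longrightarrow> \<rho> i < r" "\<And>i. i \<in> {m<..n} \<Longrightarrow> r \<le> \<rho> i"
  shows "spline_fun n \<rho> a b c \<kappa> r =
    radial_biharmonic (a - (\<Sum>i\<in>{1..m}. \<kappa> i * (ln (\<rho> i) + 1))) (b + (\<Sum>i\<in>{1..m}. \<kappa> i))
     (c + (\<Sum>i\<in>{1..m}. \<kappa> i * ((\<rho> i)\<^sup>2 * (1 - ln (\<rho> i))))) (\<Sum>i\<in>{1..m}. \<kappa> i * (\<rho> i)\<^sup>2) r"
proof -
  have "(\<Sum>i\<in>{1..n}. \<kappa> i * trunc (\<rho> i) (knot_kernel (\<rho> i)) r) = (\<Sum>i\<in>{1..m}. \<kappa> i * knot_kernel (\<rho> i) r)"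
  proof (rule sum.mono_neutral_cong_right)
    show "\<forall>i\<in>{1..n} - {1..m}. \<kappa> i * trunc (\<rho> i) (knot_kernel (\<rho> i)) r = 0"
      using assms(3) by (auto simp: trunc_def)
    show "\<kappa> i * trunc (\<rho> i) (knot_kernel (\<rho> i)) r = \<kappa> i * knot_kernel (\<rho> i) r" if "i \<in> {1..m}" for i
      using assms(2)[OF that] by (simp add: trunc_def)
  qed (use assms(1) in auto)
  then show ?thesis
    unfolding spline_fun_def sum_knot_kernel by (simp add: radial_biharmonic_def algebra_simps)
qed

lemma spline_fun_first_piece:
  assumes kn: "knots n \<rho>" and r: "r \<le> \<rho> 1"
  shows "spline_fun n \<rho> a b c \<kappa> r = radial_biharmonic a b c 0 r"
proof -
  have "r \<le> \<rho> i" if "i \<in> {0<..n}" for i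
    using knots_less[OF kn, of 1 i] r that by (cases "i = 1") auto
  then show ?thesis using spline_fun_piece[of 0 n \<rho> r a b c \<kappa>] by simp
qed

lemma C2_at_spline_fun:
  assumes kn: "knots n \<rho>" and x: "0 < x"
  shows "C2_at (\<lambda>r\<in>{0..}. complex_of_real (spline_fun n \<rho> a b c \<kappa> r)) x" (is "C2_at ?f x")
proof -
  let ?U = "{0<..} :: real set"
  define g1 where "g1 r = 2 * a * r + b * (2 * r * ln r + r)" for r :: real
  define g2 where "g2 r = 2 * a + b * (2 * ln r + 3)" for r :: real
  define G where "G j = [spline_fun n \<rho> a b c \<kappa>,
     (\<lambda>r. g1 r + (\<Sum>i\<in>{1..n}. \<kappa> i * trunc (\<rho> i) (knot_kernel1 (\<rho> i)) r)),
     (\<lambda>r. g2 r + (\<Sum>i\<in>{1..n}. \<kappa> i * trunc (\<rho> i) (knot_kernel2 (\<rho> i)) r))] ! j" for j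
  have base: "(radial_biharmonic a b c 0 has_real_derivative g1 r) (at r)"
    "(g1 has_real_derivative g2 r) (at r)" "isCont g2 r" if "0 < r" for r
  proof -
    show "(radial_biharmonic a b c 0 has_real_derivative g1 r) (at r)"
      unfolding radial_biharmonic_def g1_def using that
      by (auto intro!: derivative_eq_intros simp: field_simps power2_eq_square)
    show "(g1 has_real_derivative g2 r) (at r)"
      unfolding g1_def g2_def using that
      by (auto intro!: derivative_eq_intros simp: field_simps power2_eq_square)
    show "isCont g2 r"
      unfolding g2_def using that by (intro continuous_intros) auto
  qed
  have tr: "(trunc (\<rho> i) (knot_kernel (\<rho> i)) has_real_derivative trunc (\<rho> i) (knot_kernel1 (\<rho> i)) r) (at r)"
    "(trunc (\<rho> i) (knot_kernel1 (\<rho> i)) has_real_derivative trunc (\<rho> i) (knot_kernel2 (\<rho> i)) r) (at r)"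
    "isCont (trunc (\<rho> i) (knot_kernel2 (\<rho> i))) r"
    if "i \<in> {1..n}" for i r
    using knots_pos[OF kn, of i] that
    by (auto intro!: has_real_derivative_trunc isCont_trunc DERIV_knot_kernel knot_kernel_at_knot)
  have G: "(G j has_real_derivative G (Suc j) r) (at r)" if "j < 2" "r \<in> ?U" for j r
  proof -
    have "0 < r" using that by simp
    from \<open>j < 2\<close> consider "j = 0" | "j = 1" by linarith
    then show ?thesis
      by cases (auto simp: G_def spline_fun_def[abs_def]
          intro!: DERIV_add DERIV_sum DERIV_cmult tr base \<open>0 < r\<close>)
  qed
  have f0: "?f r = of_real (G 0 r)" if "r \<in> ?U" for r using that by (simp add: G_def)
  have jet: "(vderiv ^^ 2) ?f r = of_real (G 2 r)" if "r \<in> ?U" for r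
    using vderiv_of_real(1)[of ?U ?f G 2 2 r] f0 G that by (simp del: funpow_vderiv)
  have td: "times_differentiable_on 2 ?f ?U"
    using vderiv_of_real(2)[of ?U ?f G 2] f0 G by simp
  have "continuous_on ?U (G 2)"
    by (auto simp: G_def intro!: continuous_at_imp_continuous_on continuous_intros base tr)
  then have "continuous_on ?U (\<lambda>r. complex_of_real (G 2 r))"
    by (rule continuous_on_of_real)
  moreover have "continuous_on ?U (\<lambda>r. complex_of_real (G 2 r)) \<longleftrightarrow> continuous_on ?U ((vderiv ^^ 2) ?f)"
    by (intro continuous_on_cong refl) (simp only: jet)
  ultimately have "continuous_on ?U ((vderiv ^^ 2) ?f)" by blast
  then show ?thesis
    unfolding C2_at_def using x td by (intro exI[of _ ?U]) auto
qed

text \<open>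
  The two end conditions state that the coefficients of \<open>r^2 ln r\<close> and of \<open>r^2\<close> vanish beyond the last knot.
\<close>

lemma spline_fun_in_BL_splines:
  assumes kn: "knots n \<rho>"
    and end_cond: "b + (\<Sum>i\<in>{1..n}. \<kappa> i) = 0" "a - (\<Sum>i\<in>{1..n}. \<kappa> i * (ln (\<rho> i) + 1)) = 0"
  shows "(\<lambda>r\<in>{0..}. complex_of_real (spline_fun n \<rho> a b c \<kappa> r)) \<in> BL_splines n \<rho>" (is "?f \<in> _")
proof -
  have n: "1 \<le> n" "0 < \<rho> 1" using kn by (auto simp: knots_def)
  have le: "\<rho> i \<le> \<rho> j" if "1 \<le> i" "i \<le> j" "j \<le> n" for i j
    using knots_less[OF kn, of i j] that by (cases "i = j") auto
  have "?f \<in> Ker_L0 {\<rho> j<..<\<rho> (Suc j)}" if j: "j \<in> {1..<n}" for j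
  proof (rule radial_biharmonic_kernels(1))
    fix r assume r: "r \<in> {\<rho> j<..<\<rho> (Suc j)}"
    have "0 < r" using r knots_pos[OF kn, of j] j by auto
    have "\<rho> i < r" if "i \<in> {1..j}" for i using le[of i j] r j that by auto
    moreover have "r \<le> \<rho> i" if "i \<in> {j<..n}" for i using le[of "Suc j" i] r j that by auto
    ultimately show "?f r = of_real (radial_biharmonic (a - (\<Sum>i\<in>{1..j}. \<kappa> i * (ln (\<rho> i) + 1)))
        (b + (\<Sum>i\<in>{1..j}. \<kappa> i)) (c + (\<Sum>i\<in>{1..j}. \<kappa> i * ((\<rho> i)\<^sup>2 * (1 - ln (\<rho> i)))))
        (\<Sum>i\<in>{1..j}. \<kappa> i * (\<rho> i)\<^sup>2) r)"
      using spline_fun_piece[of j n \<rho> r] j \<open>0 < r\<close> by simp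
  qed (use knots_pos[OF kn, of j] j in auto)
  moreover have "?f \<in> Ker_G0 {0<..<\<rho> 1}"
    by (rule radial_biharmonic_kernels(2)[where A = a and B = b and C = c and D = 0])
       (use spline_fun_first_piece[OF kn] in auto)
  moreover have "?f \<in> Ker_R0 {\<rho> n<..}"
  proof (rule radial_biharmonic_kernels(3))
    fix r assume r: "r \<in> {\<rho> n<..}"
    have "0 < r" using r knots_pos[OF kn, of n] n by auto
    have "\<rho> i < r" if "i \<in> {1..n}" for i using le[of i n] r that by auto
    then show "?f r = of_real (radial_biharmonic 0 0
        (c + (\<Sum>i\<in>{1..n}. \<kappa> i * ((\<rho> i)\<^sup>2 * (1 - ln (\<rho> i)))))
        (\<Sum>i\<in>{1..n}. \<kappa> i * (\<rho> i)\<^sup>2) r)"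
      using spline_fun_piece[of n n \<rho> r a b c \<kappa>] end_cond \<open>0 < r\<close> by simp
  qed (use knots_pos[OF kn, of n] n in auto)
  moreover have "continuous (at 0 within {0..}) ?f"
  proof -
    have "((\<lambda>r. a * r\<^sup>2 + b * (r\<^sup>2 * ln r) + c) \<longlongrightarrow> a * 0\<^sup>2 + b * 0 + c) (at_right 0)"
      by (intro tendsto_intros tendsto_square_mult_ln_at_right_0)
    then have "((\<lambda>r. radial_biharmonic a b c 0 r) \<longlongrightarrow> radial_biharmonic a b c 0 0) (at_right 0)"
      by (simp add: radial_biharmonic_def)
    then have "((\<lambda>r. complex_of_real (radial_biharmonic a b c 0 r)) \<longlongrightarrow> ?f 0) (at_right 0)"
      using spline_fun_first_piece[OF kn, of 0] n by (simp add: tendsto_of_real)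
    moreover have "\<forall>\<^sub>F r in at_right 0. complex_of_real (radial_biharmonic a b c 0 r) = ?f r"
      unfolding eventually_at_right_field using n spline_fun_first_piece[OF kn]
      by (intro exI[of _ "\<rho> 1"]) auto
    ultimately have "(?f \<longlongrightarrow> ?f 0) (at_right 0)"
      by (rule Lim_transform_eventually)
    then show ?thesis
      by (simp add: continuous_within at_within_Ici_at_right)
  qed
  ultimately show ?thesis
    unfolding BL_splines_def using C2_at_spline_fun[OF kn knots_pos[OF kn]] by auto
qed

text \<open>
  The interpolation equations are triangular: the kernel of the \<open>m\<close>-th knot vanishes at the knots up to the \<open>m\<close>-th and
  is positive at the next one. The kernel of the last knot is invisible to interpolation, so its weight is free to
  satisfy the end condition for \<open>r^2 ln r\<close>.
\<close>

lemma interpolate_by_knot_kernels: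
  assumes kn: "knots n \<rho>" and start: "radial_biharmonic a b c 0 (\<rho> 1) = \<nu> 1"
  shows "\<exists>\<kappa>. (\<forall>j\<in>{1..n}. spline_fun n \<rho> a b c \<kappa> (\<rho> j) = \<nu> j) \<and> b + (\<Sum>i\<in>{1..n}. \<kappa> i) = 0"
proof -
  let ?T = "\<lambda>i r. trunc (\<rho> i) (knot_kernel (\<rho> i)) r"
  let ?S = "\<lambda>\<kappa> m r. radial_biharmonic a b c 0 r + (\<Sum>i\<in>{1..<m}. \<kappa> i * ?T i r)"
  have n: "1 \<le> n" using kn by (simp add: knots_def)
  have T0: "?T i (\<rho> j) = 0" if "1 \<le> j" "j \<le> i" "i \<le> n" for i j
    using knots_less[OF kn, of j i] that by (cases "i = j") (auto simp: trunc_def)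
  have "\<exists>\<kappa>. \<forall>j\<in>{1..m}. ?S \<kappa> m (\<rho> j) = \<nu> j" if "1 \<le> m" "m \<le> n" for m
    using that
  proof (induction m rule: nat_induct_at_least)
    case base
    then show ?case using start by simp
  next
    case (Suc m)
    then obtain \<kappa> where \<kappa>: "\<forall>j\<in>{1..m}. ?S \<kappa> m (\<rho> j) = \<nu> j" by auto
    define \<kappa>' where "\<kappa>' = \<kappa>(m := (\<nu> (Suc m) - ?S \<kappa> m (\<rho> (Suc m))) / ?T m (\<rho> (Suc m)))"
    have "?T m (\<rho> (Suc m)) \<noteq> 0"
      using knot_kernel_pos[OF knots_pos[OF kn, of m] knots_less[OF kn, of m "Suc m"]]
        knots_less[OF kn, of m "Suc m"] Suc by (simp add: trunc_def)
    moreover have S: "?S \<kappa>' (Suc m) r = ?S \<kappa> m r + \<kappa>' m * ?T m r" for r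
      using Suc by (simp add: \<kappa>'_def)
    ultimately have "?S \<kappa>' (Suc m) (\<rho> (Suc m)) = \<nu> (Suc m)"
      unfolding S by (simp add: \<kappa>'_def)
    moreover have "?S \<kappa>' (Suc m) (\<rho> j) = \<nu> j" if "j \<in> {1..m}" for j
      unfolding S using \<kappa> that T0[of j m] Suc by simp
    ultimately have "\<forall>j\<in>{1..Suc m}. ?S \<kappa>' (Suc m) (\<rho> j) = \<nu> j"
      unfolding atLeastAtMost_iff le_Suc_eq Ball_def by blast
    then show ?case by blast
  qed
  from this[OF n] obtain \<kappa> where \<kappa>: "\<forall>j\<in>{1..n}. ?S \<kappa> n (\<rho> j) = \<nu> j" by auto
  \<comment> \<open>The weight at the last knot is chosen for the end condition alone.\<close>
  define \<kappa>' where "\<kappa>' = \<kappa>(n := - b - (\<Sum>i\<in>{1..<n}. \<kappa> i))"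
  have split: "{1..n} = insert n {1..<n}" using n by auto
  have "spline_fun n \<rho> a b c \<kappa>' (\<rho> j) = \<nu> j" if "j \<in> {1..n}" for j
  proof -
    have "spline_fun n \<rho> a b c \<kappa>' (\<rho> j) = ?S \<kappa> n (\<rho> j) + \<kappa>' n * ?T n (\<rho> j)"
      unfolding spline_fun_def split by (simp add: \<kappa>'_def)
    then show ?thesis using \<kappa> that T0[of j n] by simp
  qed
  moreover have "b + (\<Sum>i\<in>{1..n}. \<kappa>' i) = 0" unfolding split by (simp add: \<kappa>'_def)
  ultimately show ?thesis by blast
qed

lemma spline_fun_linear:
  "spline_fun n \<rho> (a + t * a') (b + t * b') (c + t * c') (\<lambda>i. \<kappa> i + t * \<kappa>' i) r =
   spline_fun n \<rho> a b c \<kappa> r + t * spline_fun n \<rho> a' b' c' \<kappa>' r"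
  by (simp add: spline_fun_def radial_biharmonic_def sum.distrib sum_distrib_left algebra_simps)

text \<open>
  The primed data describe the direction in which the first piece may still vary without changing its value at the
  first knot. Along this direction the last end condition is affine in \<open>t\<close>, and it can be solved as soon as the primed
  data do not themselves extend to a spline that vanishes at all knots.
\<close>

lemma shooting:
  assumes kn: "knots n \<rho>"
    and start: "radial_biharmonic a b c 0 (\<rho> 1) = \<nu> 1" "radial_biharmonic a' b' c' 0 (\<rho> 1) = 0"
    and nondegenerate: "\<And>\<kappa>. (\<lambda>r\<in>{0..}. complex_of_real (spline_fun n \<rho> a' b' c' \<kappa> r)) \<in> BL_splines n \<rho>
      \<Longrightarrow> \<exists>j\<in>{1..n}. spline_fun n \<rho> a' b' c' \<kappa> (\<rho> j) \<noteq> 0"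
  shows "\<exists>t \<kappa>. (\<lambda>r\<in>{0..}. complex_of_real (spline_fun n \<rho> (a + t * a') (b + t * b') (c + t * c') \<kappa> r))
            \<in> BL_splines n \<rho> \<and>
          (\<forall>j\<in>{1..n}. spline_fun n \<rho> (a + t * a') (b + t * b') (c + t * c') \<kappa> (\<rho> j) = \<nu> j)"
proof -
  let ?E = "\<lambda>a \<kappa>. a - (\<Sum>i\<in>{1..n}. \<kappa> i * (ln (\<rho> i) + 1))"
  obtain \<kappa> where \<kappa>: "\<forall>j\<in>{1..n}. spline_fun n \<rho> a b c \<kappa> (\<rho> j) = \<nu> j" "b + (\<Sum>i\<in>{1..n}. \<kappa> i) = 0"
    using interpolate_by_knot_kernels[where \<nu> = \<nu>, OF kn start(1)] by blast
  obtain \<kappa>' where \<kappa>': "\<forall>j\<in>{1..n}. spline_fun n \<rho> a' b' c' \<kappa>' (\<rho> j) = 0" "b' + (\<Sum>i\<in>{1..n}. \<kappa>' i) = 0"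
    using interpolate_by_knot_kernels[where \<nu> = "\<lambda>_. 0", OF kn start(2)] by blast
  have E': "?E a' \<kappa>' \<noteq> 0"
    using nondegenerate[OF spline_fun_in_BL_splines[OF kn \<kappa>'(2)]] \<kappa>'(1) by blast
  define t where "t = - ?E a \<kappa> / ?E a' \<kappa>'"
  let ?\<kappa> = "\<lambda>i. \<kappa> i + t * \<kappa>' i"
  have "?E (a + t * a') ?\<kappa> = ?E a \<kappa> + t * ?E a' \<kappa>'"
    by (simp add: sum.distrib sum_distrib_left algebra_simps)
  then have "?E (a + t * a') ?\<kappa> = 0" using E' by (simp add: t_def)
  moreover have "(b + t * b') + (\<Sum>i\<in>{1..n}. ?\<kappa> i) = (b + (\<Sum>i\<in>{1..n}. \<kappa> i)) + t * (b' + (\<Sum>i\<in>{1..n}. \<kappa>' i))"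
    by (simp add: sum.distrib sum_distrib_left algebra_simps)
  then have "(b + t * b') + (\<Sum>i\<in>{1..n}. ?\<kappa> i) = 0" using \<kappa> \<kappa>' by simp
  ultimately have "(\<lambda>r\<in>{0..}. complex_of_real (spline_fun n \<rho> (a + t * a') (b + t * b') (c + t * c') ?\<kappa> r))
      \<in> BL_splines n \<rho>"
    by (intro spline_fun_in_BL_splines[OF kn])
  moreover have "\<forall>j\<in>{1..n}. spline_fun n \<rho> (a + t * a') (b + t * b') (c + t * c') ?\<kappa> (\<rho> j) = \<nu> j"
    using \<kappa>(1) \<kappa>'(1) unfolding spline_fun_linear by simp
  ultimately show ?thesis by blast
qed

section \<open>Existence and uniqueness\<close>

text \<open>
  Uniqueness, applied to a constructed spline and the zero spline. This is what makes shooting nondegenerate.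
\<close>

lemma vanishing_spline_fun:
  assumes kn: "knots n \<rho>"
    and f: "(\<lambda>r\<in>{0..}. complex_of_real (spline_fun n \<rho> a b c \<kappa> r)) \<in> BL_splines n \<rho>"
    and 0: "\<forall>j\<in>{1..n}. spline_fun n \<rho> a b c \<kappa> (\<rho> j) = 0"
    and bc: "b = 0 \<or> c = 0" and r: "0 < r" "r < \<rho> 1"
  shows "radial_biharmonic a b c 0 r = 0"
proof -
  let ?f = "\<lambda>a b c \<kappa>. \<lambda>r\<in>{0..}. complex_of_real (spline_fun n \<rho> a b c \<kappa> r)"
  let ?z = "?f 0 0 0 (\<lambda>_. 0)"
  have n: "0 < \<rho> 1" using kn by (simp add: knots_def)
  have z: "spline_fun n \<rho> 0 0 0 (\<lambda>_. 0) r = 0" for r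
    by (simp add: spline_fun_def radial_biharmonic_def)
  have "?f a b c \<kappa> = ?z"
  proof (rule BL_splines_eqI[OF kn f])
    show "?z \<in> BL_splines n \<rho>" by (rule spline_fun_in_BL_splines[OF kn]) simp_all
    show "?f a b c \<kappa> (\<rho> j) = ?z (\<rho> j)" if "j \<in> {1..n}" for j
      using 0 that by (simp add: z)
    have "nonsingular \<rho> (?f a b c \<kappa>)" if "b = 0"
      unfolding nonsingular_def using that spline_fun_first_piece[OF kn]
      by (intro exI[of _ "of_real a"] exI[of _ "of_real c"]) (auto simp: radial_biharmonic_def)
    moreover have "nonsingular \<rho> ?z"
      unfolding nonsingular_def by (intro exI[of _ 0]) (simp add: z)
    moreover have "?f a b c \<kappa> 0 = ?z 0" if "c = 0"
      using that n by (simp add: z spline_fun_first_piece[OF kn] radial_biharmonic_def)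
    ultimately show "?f a b c \<kappa> 0 = ?z 0 \<or> nonsingular \<rho> (?f a b c \<kappa>) \<and> nonsingular \<rho> ?z"
      using bc by blast
  qed
  then have "?f a b c \<kappa> r = ?z r" by simp
  then show ?thesis using r spline_fun_first_piece[OF kn, of r] by (simp add: z)
qed

theorem theorem2:
  fixes n :: nat and \<rho> \<nu> :: "nat \<Rightarrow> real" and \<alpha> :: real
  assumes "knots n \<rho>"
  shows "(\<exists>!\<sigma>. \<sigma> \<in> BL_splines n \<rho> \<and>
              (\<forall>j\<in>{1..n}. \<sigma> (\<rho> j) = of_real (\<nu> j)) \<and> \<sigma> 0 = of_real \<alpha>) \<and>
         (\<exists>!\<sigma>. \<sigma> \<in> BL_splines n \<rho> \<and> nonsingular \<rho> \<sigma> \<and>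
              (\<forall>j\<in>{1..n}. \<sigma> (\<rho> j) = of_real (\<nu> j)))"
proof
  note kn = assms
  let ?f = "\<lambda>a b c \<kappa>. \<lambda>r\<in>{0..}. complex_of_real (spline_fun n \<rho> a b c \<kappa> r)"
  have \<rho>1: "0 < \<rho> 1" using kn by (simp add: knots_def)
  have knot: "0 \<le> \<rho> j" if "j \<in> {1..n}" for j using knots_pos[OF kn, of j] that by simp
  show "\<exists>!\<sigma>. \<sigma> \<in> BL_splines n \<rho> \<and> (\<forall>j\<in>{1..n}. \<sigma> (\<rho> j) = of_real (\<nu> j)) \<and> \<sigma> 0 = of_real \<alpha>"
  proof (rule ex_ex1I)
    \<comment> \<open>The first piece interpolates at \<open>0\<close> and \<open>\<rho> 1\<close>; adding a multiple of \<open>r\<^sup>2 (ln r - ln (\<rho> 1))\<close> keeps both values.\<close>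
    have "\<exists>t \<kappa>. ?f ((\<nu> 1 - \<alpha>) / (\<rho> 1)\<^sup>2 + t * - ln (\<rho> 1)) (0 + t * 1) (\<alpha> + t * 0) \<kappa> \<in> BL_splines n \<rho> \<and>
        (\<forall>j\<in>{1..n}. spline_fun n \<rho> ((\<nu> 1 - \<alpha>) / (\<rho> 1)\<^sup>2 + t * - ln (\<rho> 1)) (0 + t * 1) (\<alpha> + t * 0) \<kappa> (\<rho> j) = \<nu> j)"
    proof (rule shooting[OF kn])
      show "\<exists>j\<in>{1..n}. spline_fun n \<rho> (- ln (\<rho> 1)) 1 0 \<kappa> (\<rho> j) \<noteq> 0"
        if "?f (- ln (\<rho> 1)) 1 0 \<kappa> \<in> BL_splines n \<rho>" for \<kappa>
      proof (rule ccontr)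
        assume "\<not> ?thesis"
        then have "radial_biharmonic (- ln (\<rho> 1)) 1 0 0 (\<rho> 1 / 2) = 0"
          using vanishing_spline_fun[OF kn that, of "\<rho> 1 / 2"] \<rho>1 by simp
        then have "(\<rho> 1 / 2)\<^sup>2 * (ln (\<rho> 1 / 2) - ln (\<rho> 1)) = 0"
          by (simp only: radial_biharmonic_def) (simp add: algebra_simps)
        then show False using \<rho>1 by (simp add: ln_div)
      qed
    qed (use \<rho>1 in \<open>simp_all add: radial_biharmonic_def\<close>)
    then obtain a b \<kappa> where f: "?f a b \<alpha> \<kappa> \<in> BL_splines n \<rho>"
        "\<forall>j\<in>{1..n}. spline_fun n \<rho> a b \<alpha> \<kappa> (\<rho> j) = \<nu> j" by (auto simp del: restrict_apply)
    have "?f a b \<alpha> \<kappa> 0 = of_real \<alpha>"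
      using \<rho>1 by (simp add: spline_fun_first_piece[OF kn] radial_biharmonic_def)
    then show "\<exists>\<sigma>. \<sigma> \<in> BL_splines n \<rho> \<and> (\<forall>j\<in>{1..n}. \<sigma> (\<rho> j) = of_real (\<nu> j)) \<and> \<sigma> 0 = of_real \<alpha>"
      using f knot by (intro exI[of _ "?f a b \<alpha> \<kappa>"]) simp
  qed (intro BL_splines_eqI[OF kn]; simp)
  show "\<exists>!\<sigma>. \<sigma> \<in> BL_splines n \<rho> \<and> nonsingular \<rho> \<sigma> \<and> (\<forall>j\<in>{1..n}. \<sigma> (\<rho> j) = of_real (\<nu> j))"
  proof (rule ex_ex1I)
    \<comment> \<open>Nonsingular first pieces through \<open>\<nu> 1\<close> differ by multiples of \<open>r\<^sup>2 - (\<rho> 1)\<^sup>2\<close>.\<close>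
    have "\<exists>t \<kappa>. ?f (0 + t * 1) (0 + t * 0) (\<nu> 1 + t * - (\<rho> 1)\<^sup>2) \<kappa> \<in> BL_splines n \<rho> \<and>
        (\<forall>j\<in>{1..n}. spline_fun n \<rho> (0 + t * 1) (0 + t * 0) (\<nu> 1 + t * - (\<rho> 1)\<^sup>2) \<kappa> (\<rho> j) = \<nu> j)"
    proof (rule shooting[OF kn])
      show "\<exists>j\<in>{1..n}. spline_fun n \<rho> 1 0 (- (\<rho> 1)\<^sup>2) \<kappa> (\<rho> j) \<noteq> 0"
        if "?f 1 0 (- (\<rho> 1)\<^sup>2) \<kappa> \<in> BL_splines n \<rho>" for \<kappa>
      proof (rule ccontr)
        assume "\<not> ?thesis"
        then have "radial_biharmonic 1 0 (- (\<rho> 1)\<^sup>2) 0 (\<rho> 1 / 2) = 0"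
          using vanishing_spline_fun[OF kn that, of "\<rho> 1 / 2"] \<rho>1 by simp
        then show False using \<rho>1 by (simp add: radial_biharmonic_def power2_eq_square)
      qed
    qed (simp_all add: radial_biharmonic_def)
    then obtain a c \<kappa> where f: "?f a 0 c \<kappa> \<in> BL_splines n \<rho>"
        "\<forall>j\<in>{1..n}. spline_fun n \<rho> a 0 c \<kappa> (\<rho> j) = \<nu> j" by (auto simp del: restrict_apply)
    have "nonsingular \<rho> (?f a 0 c \<kappa>)"
      unfolding nonsingular_def using spline_fun_first_piece[OF kn]
      by (intro exI[of _ "of_real a"] exI[of _ "of_real c"]) (auto simp: radial_biharmonic_def)
    then show "\<exists>\<sigma>. \<sigma> \<in> BL_splines n \<rho> \<and> nonsingular \<rho> \<sigma> \<and> (\<forall>j\<in>{1..n}. \<sigma> (\<rho> j) = of_real (\<nu> j))"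
      using f knot by (intro exI[of _ "?f a 0 c \<kappa>"]) simp
  qed (intro BL_splines_eqI[OF kn]; simp)
qed

end
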